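(* Let $\mathbf{X}=(X_t)$ be a square-integrable harness with respect to a past-future filtration $(\mathcal{F}_{s,t})$ on an open interval $(T_0,T_1)\subset\mathbb{R}$, with mean $\mathbb{E}(X_t)=\alpha+\beta t$ and with covariance $$\operatorname{Cov}(X_s,X_t)=(as+b)(ct+d),\qquad s<t,$$ where $ad-bc>0$ and $(at+b)(ct+d)>0$ for $t\in(T_0,T_1)$. Suppose that there are constants $\chi,\eta,\theta,\sigma,\tau,\rho$ and a non-random function $F_{t,s,u}$ of $s<t<u$ such that $$\operatorname{Var}(X_t|\mathcal{F}_{s,u})=F_{t,s,u}\Big(\chi+\eta\tfrac{uX_s-sX_u}{u-s}+\theta\tfrac{X_u-X_s}{u-s}+\sigma\tfrac{(uX_s-sX_u)^2}{(u-s)^2}+\tau\tfrac{(X_u-X_s)^2}{(u-s)^2}+\rho\tfrac{(X_u-X_s)(uX_s-sX_u)}{(u-s)^2}\Big),$$ and that $$\widetilde\chi:=\chi+\alpha\eta+\theta\beta+\sigma\alpha^2+\tau\beta^2+\rho\alpha\beta>0.$$ Let $\psi(t)=(dt-b)/(a-ct)$. Then the process $$Y_t=\frac{a-ct}{ad-bc}\big(X_{\psi(t)}-\alpha-\beta\psi(t)\big)$$ is a standard quadratic harness on the interval $\left(\frac{aT_0+b}{cT_0+d},\frac{aT_1+b}{cT_1+d}\right)\subset(0,\infty)$ (endpoints understood as limits if necessary), with respect to the past-future filtration $(\mathcal{F}_{\psi(s),\psi(u)})_{s<u}$, and $\mathbf{Y}\in QH(\eta',\theta';\sigma',\tau';1+\rho')$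 with $$\eta'=\big(d(\eta+\beta\rho+2\alpha\sigma)+c(\theta+\alpha\rho+2\beta\tau)\big)/\widetilde\chi,$$ $$\theta'=\big(b(\eta+\beta\rho+2\alpha\sigma)+a(\theta+\alpha\rho+2\beta\tau)\big)/\widetilde\chi,$$ $$\sigma'=(\tau c^2+d\rho c+d^2\sigma)/\widetilde\chi,\qquad \tau'=(\tau a^2+b\rho a+b^2\sigma)/\widetilde\chi,$$ $$\rho'=(bc\rho+ad\rho+2bd\sigma+2ac\tau)/\widetilde\chi .$$
   Context: **Past-future filtration.** For a nonempty open interval $\mathcal{T}$, a past-future filtration is a family of $\sigma$-fields $(\mathcal{F}_{s,t})_{s<t,\ s,t\in\mathcal{T}}$ with $\mathcal{F}_{r,u}\subset\mathcal{F}_{s,t}$ whenever $r\le s<t\le u$. $T_0=-\infty$ or $T_1=\infty$ is allowed. **Harness.** An integrable process $(X_t)_{t\in\mathcal{T}}$ such that $X_s,X_t$ are $\mathcal{F}_{s,t}$-measurable is a harness with respect to $(\mathcal{F}_{s,t})$ if for all $s<t<u$ in $\mathcal{T}$, $\mathbb{E}(X_t|\mathcal{F}_{s,u})=\frac{u-t}{u-s}X_s+\frac{t-s}{u-s}X_u$. **Standard quadratic harness; notation $QH$.** $\mathbf{Y}\in QH(\eta,\theta;\sigma,\tau;\gamma)$ on an interval contained in $(0,\infty)$ means: $\mathbf{Y}$ is a square-integrable harness, $\mathbb{E}(Y_t)=0$, $\mathbb{E}(Y_sY_t)=\min\{s,t\}$, and there is a non-random function $F_{t,s,u}$ of $s<t<u$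 such that the conditional variance of $Y_t$ given the $(s,u)$ member of the past-future filtration equals $$F_{t,s,u}\Big(1+\eta\tfrac{uY_s-sY_u}{u-s}+\theta\tfrac{Y_u-Y_s}{u-s}+\sigma\tfrac{(uY_s-sY_u)^2}{(u-s)^2}+\tau\tfrac{(Y_u-Y_s)^2}{(u-s)^2}-(1-\gamma)\tfrac{(Y_u-Y_s)(uY_s-sY_u)}{(u-s)^2}\Big).$$ Such a $\mathbf{Y}$ is called a standard quadratic harness. *)

theory Defs
  imports "HOL-Probability.Probability"
begin

text \<open>Time points are real, so processes and filtrations are indexed by all reals; every
  condition below is restricted to indices in the time interval \<open>T\<close>.\<close>

locale past_future_filtration = prob_space M
  for M :: "'a measure" +
  fixes T :: "real set" and \<F> :: "real \<Rightarrow> real \<Rightarrow> 'a measure"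
  assumes times_nonempty: "T \<noteq> {}"
    and times_open: "open T"
    and times_connected: "is_interval T"
    and sub_sigma: "\<And>s t. \<lbrakk>s \<in> T; t \<in> T; s < t\<rbrakk> \<Longrightarrow> subalgebra M (\<F> s t)"
    and past_future: "\<And>r s t u. \<lbrakk>r \<in> T; s \<in> T; t \<in> T; u \<in> T; r \<le> s; s < t; t \<le> u\<rbrakk>
                        \<Longrightarrow> sets (\<F> r u) \<subseteq> sets (\<F> s t)"

locale harness = past_future_filtration M T \<F>
  for M :: "'a measure" and T and \<F> +
  fixes X :: "real \<Rightarrow> 'a \<Rightarrow> real"
  assumes integrable_process: "\<And>t. t \<in> T \<Longrightarrow> integrable M (X t)"
    and adapted: "\<And>s t. \<lbrakk>s \<in> T; t \<in> T; s < t\<rbrakk>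
                    \<Longrightarrow> X s \<in> borel_measurable (\<F> s t) \<and> X t \<in> borel_measurable (\<F> s t)"
    and harness_eq: "\<And>s t u. \<lbrakk>s \<in> T; t \<in> T; u \<in> T; s < t; t < u\<rbrakk>
          \<Longrightarrow> AE \<omega> in M. real_cond_exp M (\<F> s u) (X t) \<omega>
                = (u - t) / (u - s) * X s \<omega> + (t - s) / (u - s) * X u \<omega>"

locale square_integrable_harness = harness +
  assumes square_integrable: "\<And>t. t \<in> T \<Longrightarrow> integrable M (\<lambda>\<omega>. (X t \<omega>)\<^sup>2)"

definition covariance :: "'a measure \<Rightarrow> ('a \<Rightarrow> real) \<Rightarrow> ('a \<Rightarrow> real) \<Rightarrow> real" where
  "covariance M f g =
     (\<integral>\<omega>. (f \<omega> - (\<integral>\<omega>'. f \<omega>' \<partial>M)) * (g \<omega> - (\<integral>\<omega>'. g \<omega>' \<partial>M)) \<partial>M)"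

definition cond_variance :: "'a measure \<Rightarrow> 'a measure \<Rightarrow> ('a \<Rightarrow> real) \<Rightarrow> 'a \<Rightarrow> real" where
  "cond_variance M G f = real_cond_exp M G (\<lambda>\<omega>. (f \<omega> - real_cond_exp M G f \<omega>)\<^sup>2)"

text \<open>The quadratic expression in the values \<open>x\<close> at time \<open>s\<close> and \<open>y\<close> at time \<open>u\<close>.\<close>

definition harness_quadratic ::
  "real \<Rightarrow> real \<Rightarrow> real \<Rightarrow> real \<Rightarrow> real \<Rightarrow> real \<Rightarrow> real \<Rightarrow> real \<Rightarrow> real \<Rightarrow> real \<Rightarrow> real" where
  "harness_quadratic chi \<eta> \<theta> \<sigma> \<tau> \<rho> s u x y =
     chi + \<eta> * ((u * x - s * y) / (u - s)) + \<theta> * ((y - x) / (u - s))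
       + \<sigma> * ((u * x - s * y)\<^sup>2 / (u - s)\<^sup>2) + \<tau> * ((y - x)\<^sup>2 / (u - s)\<^sup>2)
       + \<rho> * ((y - x) * (u * x - s * y) / (u - s)\<^sup>2)"

text \<open>The locale predicate below renders \<open>Y \<in> QH(\<eta>,\<theta>;\<sigma>,\<tau>;\<gamma>)\<close>; a process is a standard
  quadratic harness if this holds for some parameters.\<close>

locale standard_quadratic_harness = square_integrable_harness M T \<F> Y
  for M :: "'a measure" and T and \<F> and Y +
  fixes \<eta> \<theta> \<sigma> \<tau> \<gamma> :: real
  assumes positive_times: "T \<subseteq> {0<..}"
    and mean_zero: "\<And>t. t \<in> T \<Longrightarrow> expectation (Y t) = 0"
    and covariance_min: "\<And>s t. \<lbrakk>s \<in> T; t \<in> T\<rbrakk> \<Longrightarrow> expectation (\<lambda>\<omega>. Y s \<omega> * Y t \<omega>) = min s t"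
    and quadratic_cond_variance:
      "\<exists>V :: real \<Rightarrow> real \<Rightarrow> real \<Rightarrow> real.
         \<forall>s\<in>T. \<forall>t\<in>T. \<forall>u\<in>T. s < t \<and> t < u \<longrightarrow>
           (AE \<omega> in M. cond_variance M (\<F> s u) (Y t) \<omega>
              = V t s u * harness_quadratic 1 \<eta> \<theta> \<sigma> \<tau> (- (1 - \<gamma>)) s u (Y s \<omega>) (Y u \<omega>))"

end

theory Submission
  imports Defs
begin

text \<open>Where \<open>S = \<phi> s\<close> we have \<open>Y S = (X s - \<alpha> - \<beta> * s) / (c * s + d)\<close>. For \<open>s < u\<close>, \<open>U = \<phi> u\<close>, put
  \<open>A = (U * Y S - S * Y U) / (U - S)\<close> and \<open>B = (Y U - Y S) / (U - S)\<close>. The corresponding expressions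
  for \<open>X\<close> are the affine functions \<open>\<alpha> + d * A + b * B\<close> and \<open>\<beta> + c * A + a * B\<close> of these, with
  coefficients independent of \<open>s\<close> and \<open>u\<close>, so a quadratic polynomial in the former is one in the
  latter; its constant term is \<open>chi'\<close>.\<close>

section \<open>Monotone images of intervals\<close>

text \<open>A point strictly between \<open>T\<^sub>0\<close> and a real number is itself real, even
  if \<open>T\<^sub>0\<close> is minus infinity. So a limit at the left end, formed in the extended
  reals, involves real times only.\<close>

lemma eventually_at_right_einterval:
  fixes T\<^sub>0 T\<^sub>1 :: ereal
  assumes "t \<in> einterval T\<^sub>0 T\<^sub>1"
    and "\<And>y. \<lbrakk>y \<in> einterval T\<^sub>0 T\<^sub>1; y < t\<rbrakk> \<Longrightarrow> P (ereal y)"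
  shows "eventually P (at_right T\<^sub>0)"
  unfolding eventually_at_right[of T\<^sub>0 "ereal t", simplified, OF conjunct1[OF assms(1)[unfolded einterval_iff]]]
proof (intro exI[of _ "ereal t"] conjI allI impI)
  show "T\<^sub>0 < ereal t" using assms(1) by (simp add: einterval_iff)
  fix y assume "T\<^sub>0 < y" "y < ereal t"
  then obtain r where "y = ereal r" by (cases y) auto
  moreover from this have "r \<in> einterval T\<^sub>0 T\<^sub>1"
    using \<open>T\<^sub>0 < y\<close> \<open>y < ereal t\<close> assms(1) less_trans[of y "ereal t" T\<^sub>1]
    by (simp add: einterval_iff)
  ultimately show "P y" using assms(2) \<open>y < ereal t\<close> by simp
qed

lemma eventually_at_left_einterval:
  fixes T\<^sub>0 T\<^sub>1 :: ereal
  assumes "t \<in> einterval T\<^sub>0 T\<^sub>1"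
    and "\<And>y. \<lbrakk>y \<in> einterval T\<^sub>0 T\<^sub>1; t < y\<rbrakk> \<Longrightarrow> P (ereal y)"
  shows "eventually P (at_left T\<^sub>1)"
  unfolding eventually_at_left[of "ereal t" T\<^sub>1, simplified, OF conjunct2[OF assms(1)[unfolded einterval_iff]]]
proof (intro exI[of _ "ereal t"] conjI allI impI)
  show "ereal t < T\<^sub>1" using assms(1) by (simp add: einterval_iff)
  fix y assume "ereal t < y" "y < T\<^sub>1"
  then obtain r where "y = ereal r" by (cases y) auto
  moreover from this have "r \<in> einterval T\<^sub>0 T\<^sub>1"
    using \<open>ereal t < y\<close> \<open>y < T\<^sub>1\<close> assms(1) less_trans[of T\<^sub>0 "ereal t" y]
    by (simp add: einterval_iff)
  ultimately show "P y" using assms(2) \<open>ereal t < y\<close> by simp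
qed

lemma einterval_dense:
  assumes "t \<in> einterval T\<^sub>0 T\<^sub>1"
  obtains r s where "r \<in> einterval T\<^sub>0 T\<^sub>1" "s \<in> einterval T\<^sub>0 T\<^sub>1" "r < t" "t < s"
proof -
  have "T\<^sub>0 < ereal t" "ereal t < T\<^sub>1" using assms by (auto simp: einterval_iff)
  then obtain r s where "T\<^sub>0 < ereal r" "ereal r < ereal t" "ereal t < ereal s" "ereal s < T\<^sub>1"
    using ereal_dense2[of T\<^sub>0 "ereal t"] ereal_dense2[of "ereal t" T\<^sub>1] by blast
  then have "r \<in> einterval T\<^sub>0 T\<^sub>1" "s \<in> einterval T\<^sub>0 T\<^sub>1" "r < t" "t < s"
    using \<open>T\<^sub>0 < ereal t\<close> \<open>ereal t < T\<^sub>1\<close> less_trans[of "ereal r" "ereal t" T\<^sub>1]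
      less_trans[of T\<^sub>0 "ereal t" "ereal s"]
    by (auto simp: einterval_iff)
  then show ?thesis by (rule that)
qed

lemma is_interval_einterval: "is_interval (einterval T\<^sub>0 T\<^sub>1)"
proof (unfold is_interval_1 einterval_iff, intro ballI allI impI)
  fix r s x assume "r \<in> einterval T\<^sub>0 T\<^sub>1" "s \<in> einterval T\<^sub>0 T\<^sub>1" "r \<le> x \<and> x \<le> s"
  then show "T\<^sub>0 < ereal x \<and> ereal x < T\<^sub>1"
    using less_le_trans[of T\<^sub>0 "ereal r" "ereal x"] le_less_trans[of "ereal x" "ereal s" T\<^sub>1]
    by (simp add: einterval_iff)
qed

text \<open>The endpoints are the infimum and supremum of the values, taken in the extended reals so
  that they always exist. Monotonicity makes them one-sided limits, openness of the domain keeps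
  them from being attained, and the intermediate value theorem leaves no gap between them.\<close>

lemma strict_mono_image_einterval:
  fixes f :: "real \<Rightarrow> real" and T\<^sub>0 T\<^sub>1 :: ereal
  assumes ne: "einterval T\<^sub>0 T\<^sub>1 \<noteq> {}"
    and cont: "continuous_on (einterval T\<^sub>0 T\<^sub>1) f"
    and mono: "strict_mono_on (einterval T\<^sub>0 T\<^sub>1) f"
  obtains U\<^sub>0 U\<^sub>1 :: ereal
  where "((ereal \<circ> f \<circ> real_of_ereal) \<longlongrightarrow> U\<^sub>0) (at_right T\<^sub>0)"
    and "((ereal \<circ> f \<circ> real_of_ereal) \<longlongrightarrow> U\<^sub>1) (at_left T\<^sub>1)"
    and "f ` einterval T\<^sub>0 T\<^sub>1 = einterval U\<^sub>0 U\<^sub>1"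
proof
  define U\<^sub>0 where "U\<^sub>0 = (INF t\<in>einterval T\<^sub>0 T\<^sub>1. ereal (f t))"
  define U\<^sub>1 where "U\<^sub>1 = (SUP t\<in>einterval T\<^sub>0 T\<^sub>1. ereal (f t))"
  have lb: "U\<^sub>0 \<le> ereal (f t)" and ub: "ereal (f t) \<le> U\<^sub>1" if "t \<in> einterval T\<^sub>0 T\<^sub>1" for t
    using that unfolding U\<^sub>0_def U\<^sub>1_def by (auto intro: INF_lower SUP_upper)
  have lt: "f s < f t" if "s \<in> einterval T\<^sub>0 T\<^sub>1" "t \<in> einterval T\<^sub>0 T\<^sub>1" "s < t" for s t
    using mono that by (auto simp: strict_mono_on_def)
  obtain t\<^sub>0 where t\<^sub>0: "t\<^sub>0 \<in> einterval T\<^sub>0 T\<^sub>1" using ne by blast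
  show "((ereal \<circ> f \<circ> real_of_ereal) \<longlongrightarrow> U\<^sub>0) (at_right T\<^sub>0)"
  proof (rule order_tendstoI)
    fix l assume "l < U\<^sub>0"
    then show "eventually (\<lambda>x. l < (ereal \<circ> f \<circ> real_of_ereal) x) (at_right T\<^sub>0)"
      by (intro eventually_at_right_einterval[OF t\<^sub>0]) (simp add: less_le_trans[OF _ lb])
  next
    fix x assume "U\<^sub>0 < x"
    then obtain t where t: "t \<in> einterval T\<^sub>0 T\<^sub>1" "ereal (f t) < x"
      unfolding U\<^sub>0_def by (auto simp: INF_less_iff)
    show "eventually (\<lambda>y. (ereal \<circ> f \<circ> real_of_ereal) y < x) (at_right T\<^sub>0)"
    proof (rule eventually_at_right_einterval[OF t(1)])
      fix y assume "y \<in> einterval T\<^sub>0 T\<^sub>1" "y < t"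
      then have "ereal (f y) < ereal (f t)" using lt t by simp
      then show "(ereal \<circ> f \<circ> real_of_ereal) (ereal y) < x"
        using less_trans[OF _ t(2), of "ereal (f y)"] by simp
    qed
  qed
  show "((ereal \<circ> f \<circ> real_of_ereal) \<longlongrightarrow> U\<^sub>1) (at_left T\<^sub>1)"
  proof (rule order_tendstoI)
    fix x assume "U\<^sub>1 < x"
    then show "eventually (\<lambda>y. (ereal \<circ> f \<circ> real_of_ereal) y < x) (at_left T\<^sub>1)"
      by (intro eventually_at_left_einterval[OF t\<^sub>0]) (simp add: le_less_trans[OF ub])
  next
    fix l assume "l < U\<^sub>1"
    then obtain t where t: "t \<in> einterval T\<^sub>0 T\<^sub>1" "l < ereal (f t)"
      unfolding U\<^sub>1_def by (auto simp: less_SUP_iff)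
    show "eventually (\<lambda>x. l < (ereal \<circ> f \<circ> real_of_ereal) x) (at_left T\<^sub>1)"
    proof (rule eventually_at_left_einterval[OF t(1)])
      fix y assume "y \<in> einterval T\<^sub>0 T\<^sub>1" "t < y"
      then have "ereal (f t) < ereal (f y)" using lt t by simp
      then show "l < (ereal \<circ> f \<circ> real_of_ereal) (ereal y)"
        using less_trans[OF t(2), of "ereal (f y)"] by simp
    qed
  qed
  show "f ` einterval T\<^sub>0 T\<^sub>1 = einterval U\<^sub>0 U\<^sub>1"
  proof (intro equalityI subsetI)
    fix x assume "x \<in> f ` einterval T\<^sub>0 T\<^sub>1"
    then obtain t where t: "t \<in> einterval T\<^sub>0 T\<^sub>1" "x = f t" by blast
    obtain r s where rs: "r \<in> einterval T\<^sub>0 T\<^sub>1" "s \<in> einterval T\<^sub>0 T\<^sub>1" "r < t" "t < s"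
      using einterval_dense[OF t(1)] .
    have "U\<^sub>0 < ereal x" using lb[OF rs(1)] lt[OF rs(1) t(1) rs(3)] t(2)
      using le_less_trans[of U\<^sub>0 "ereal (f r)" "ereal (f t)"] by simp
    moreover have "ereal x < U\<^sub>1" using ub[OF rs(2)] lt[OF t(1) rs(2) rs(4)] t(2)
      using less_le_trans[of "ereal (f t)" "ereal (f s)" U\<^sub>1] by simp
    ultimately show "x \<in> einterval U\<^sub>0 U\<^sub>1" by (simp add: einterval_iff)
  next
    fix x assume "x \<in> einterval U\<^sub>0 U\<^sub>1"
    then have "U\<^sub>0 < ereal x" "ereal x < U\<^sub>1" by (simp_all add: einterval_iff)
    then obtain r s where rs: "r \<in> einterval T\<^sub>0 T\<^sub>1" "f r < x" "s \<in> einterval T\<^sub>0 T\<^sub>1" "x < f s"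
      unfolding U\<^sub>0_def U\<^sub>1_def by (auto simp: INF_less_iff less_SUP_iff)
    have "is_interval (f ` einterval T\<^sub>0 T\<^sub>1)"
      using connected_continuous_image[OF cont] is_interval_einterval
      by (simp add: is_interval_connected_1)
    then show "x \<in> f ` einterval T\<^sub>0 T\<^sub>1"
      using mem_is_interval_1_I[of _ "f r" "f s" x] rs by simp
  qed
qed

section \<open>Conditional moments of harnesses\<close>

lemma integrable_mult_of_square_integrable:
  fixes f g :: "'a \<Rightarrow> real"
  assumes "f \<in> borel_measurable M" "g \<in> borel_measurable M"
    and "integrable M (\<lambda>x. (f x)\<^sup>2)" "integrable M (\<lambda>x. (g x)\<^sup>2)"
  shows "integrable M (\<lambda>x. f x * g x)"
proof (rule Bochner_Integration.integrable_bound)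
  show "integrable M (\<lambda>x. (f x)\<^sup>2 + (g x)\<^sup>2)" using assms by simp
  show "(\<lambda>x. f x * g x) \<in> borel_measurable M" using assms by simp
  have "\<bar>f x * g x\<bar> \<le> \<bar>(f x)\<^sup>2 + (g x)\<^sup>2\<bar>" for x
  proof -
    have "2 * (\<bar>f x\<bar> * \<bar>g x\<bar>) \<le> (f x)\<^sup>2 + (g x)\<^sup>2" "0 \<le> \<bar>f x\<bar> * \<bar>g x\<bar>"
      using sum_squares_bound[of "\<bar>f x\<bar>" "\<bar>g x\<bar>"] by (simp_all add: mult.assoc)
    then show ?thesis unfolding abs_mult by linarith
  qed
  then show "AE x in M. norm (f x * g x) \<le> norm ((f x)\<^sup>2 + (g x)\<^sup>2)" by simp
qed

lemma integrable_square_add: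
  fixes f g :: "'a \<Rightarrow> real"
  assumes "f \<in> borel_measurable M" "g \<in> borel_measurable M"
    and "integrable M (\<lambda>x. (f x)\<^sup>2)" "integrable M (\<lambda>x. (g x)\<^sup>2)"
  shows "integrable M (\<lambda>x. (f x + g x)\<^sup>2)"
  using integrable_mult_of_square_integrable[OF assms] assms(3,4)
  by (simp add: power2_sum mult.assoc)

lemma integrable_square_cmult:
  fixes f :: "'a \<Rightarrow> real"
  assumes "integrable M (\<lambda>x. (f x)\<^sup>2)"
  shows "integrable M (\<lambda>x. (k * f x)\<^sup>2)"
  using assms by (simp add: power_mult_distrib)

lemma (in finite_measure_subalgebra) real_cond_exp_affine:
  assumes "integrable M f"
  shows "AE x in M. real_cond_exp M F (\<lambda>x. k * f x + m) x = k * real_cond_exp M F f x + m"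
proof -
  have "AE x in M. real_cond_exp M F (\<lambda>x. k * f x + m) x
      = real_cond_exp M F (\<lambda>x. k * f x) x + real_cond_exp M F (\<lambda>x. m) x"
    using assms by (intro real_cond_exp_add) auto
  moreover have "AE x in M. real_cond_exp M F (\<lambda>x. m) x = m"
    by (rule real_cond_exp_F_meas) auto
  ultimately show ?thesis using real_cond_exp_cmult[OF assms, of k] by eventually_elim simp
qed

text \<open>Subtracting the conditional mean cancels \<open>m\<close> and leaves the factor
  \<open>k\<close>, which comes out squared. Square integrability is asked of the deviation itself,
  since for a harness the deviation is explicit.\<close>

lemma (in finite_measure_subalgebra) cond_variance_affine:
  assumes f: "integrable M f"
    and sq: "integrable M (\<lambda>x. (f x - real_cond_exp M F f x)\<^sup>2)"
  shows "AE x in M. cond_variance M F (\<lambda>x. k * f x + m) x = k\<^sup>2 * cond_variance M F f x"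
proof -
  have [measurable]: "f \<in> borel_measurable M" using f by auto
  have "AE x in M. real_cond_exp M F (\<lambda>x. (k * f x + m - real_cond_exp M F (\<lambda>x. k * f x + m) x)\<^sup>2) x
      = real_cond_exp M F (\<lambda>x. k\<^sup>2 * (f x - real_cond_exp M F f x)\<^sup>2) x"
  proof (rule real_cond_exp_cong)
    show "AE x in M. (k * f x + m - real_cond_exp M F (\<lambda>x. k * f x + m) x)\<^sup>2
        = k\<^sup>2 * (f x - real_cond_exp M F f x)\<^sup>2"
      using real_cond_exp_affine[OF f, of k m]
      by eventually_elim (simp add: power_mult_distrib[symmetric] right_diff_distrib)
  qed measurable
  then show ?thesis
    unfolding cond_variance_def using real_cond_exp_cmult[OF sq, of "k\<^sup>2"]
    by eventually_elim simp
qed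

context past_future_filtration
begin

lemma finite_measure_subalgebra_sigma:
  assumes "s \<in> T" "t \<in> T" "s < t"
  shows "finite_measure_subalgebra M (\<F> s t)"
  by (intro finite_measure_subalgebra.intro finite_measure_axioms
      finite_measure_subalgebra_axioms.intro sub_sigma assms)

end

context square_integrable_harness
begin

lemma borel_measurable_process: "t \<in> T \<Longrightarrow> X t \<in> borel_measurable M"
  using integrable_process by blast

lemma integrable_product: "s \<in> T \<Longrightarrow> t \<in> T \<Longrightarrow> integrable M (\<lambda>\<omega>. X s \<omega> * X t \<omega>)"
  by (intro integrable_mult_of_square_integrable borel_measurable_process square_integrable)

text \<open>By the harness equation, the deviation of \<open>X t\<close> from its conditional mean
  is almost everywhere a linear combination of \<open>X s\<close>, \<open>X t\<close> and
  \<open>X u\<close>, hence square integrable.\<close>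

lemma cond_variance_affine_process:
  assumes T: "s \<in> T" "t \<in> T" "u \<in> T" "s < t" "t < u"
  shows "AE \<omega> in M. cond_variance M (\<F> s u) (\<lambda>\<omega>. k * X t \<omega> + m) \<omega>
    = k\<^sup>2 * cond_variance M (\<F> s u) (X t) \<omega>"
proof -
  interpret G: finite_measure_subalgebra M "\<F> s u"
    using finite_measure_subalgebra_sigma T by simp
  note [measurable] = borel_measurable_process[OF T(1)] borel_measurable_process[OF T(2)]
    borel_measurable_process[OF T(3)]
  \<comment> \<open>The harness weights with sign reversed, so that the sum below is the deviation
    of \<open>X t\<close> from its conditional mean.\<close>
  let ?p = "- ((u - t) / (u - s))" and ?q = "- ((t - s) / (u - s))"
  have "integrable M (\<lambda>\<omega>. (X t \<omega> + (?p * X s \<omega> + ?q * X u \<omega>))\<^sup>2)"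
    by (intro integrable_square_add integrable_square_cmult square_integrable T) measurable
  then have "integrable M (\<lambda>\<omega>. (X t \<omega> - real_cond_exp M (\<F> s u) (X t) \<omega>)\<^sup>2)"
  proof (rule integrable_cong_AE_imp)
    show "AE \<omega> in M. (X t \<omega> + (?p * X s \<omega> + ?q * X u \<omega>))\<^sup>2
        = (X t \<omega> - real_cond_exp M (\<F> s u) (X t) \<omega>)\<^sup>2"
      using harness_eq[OF T]
      by eventually_elim (simp add: algebra_simps)
  qed measurable
  then show ?thesis
    by (intro G.cond_variance_affine integrable_process T)
qed

text \<open>Since \<open>X s\<close> is measurable for the conditioning field, \<open>X t\<close>
  may be replaced by its conditional mean under the expectation. Thus \<open>E (X s * X t)\<close>
  interpolates linearly in \<open>t\<close> between its values at \<open>s\<close> and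
  \<open>u\<close>.\<close>

lemma second_moment_interpolation:
  assumes T: "s \<in> T" "t \<in> T" "u \<in> T" "s < t" "t < u"
  shows "(u - s) * expectation (\<lambda>\<omega>. X s \<omega> * X t \<omega>)
    = (u - t) * expectation (\<lambda>\<omega>. (X s \<omega>)\<^sup>2) + (t - s) * expectation (\<lambda>\<omega>. X s \<omega> * X u \<omega>)"
proof -
  interpret G: finite_measure_subalgebra M "\<F> s u"
    using finite_measure_subalgebra_sigma T by simp
  note [measurable] = borel_measurable_process[OF T(1)] borel_measurable_process[OF T(2)]
    borel_measurable_process[OF T(3)]
  have "expectation (\<lambda>\<omega>. X s \<omega> * X t \<omega>)
      = expectation (\<lambda>\<omega>. X s \<omega> * real_cond_exp M (\<F> s u) (X t) \<omega>)"
    using adapted[of s u] T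
    by (intro G.real_cond_exp_intg(2)[symmetric] integrable_product borel_measurable_process) auto
  also have "\<dots> = expectation (\<lambda>\<omega>. (u - t) / (u - s) * (X s \<omega>)\<^sup>2
                                + (t - s) / (u - s) * (X s \<omega> * X u \<omega>))"
  proof (rule integral_cong_AE)
    show "AE \<omega> in M. X s \<omega> * real_cond_exp M (\<F> s u) (X t) \<omega>
        = (u - t) / (u - s) * (X s \<omega>)\<^sup>2 + (t - s) / (u - s) * (X s \<omega> * X u \<omega>)"
      using harness_eq[OF T] by eventually_elim (simp add: algebra_simps power2_eq_square)
  qed measurable
  also have "\<dots> = (u - t) / (u - s) * expectation (\<lambda>\<omega>. (X s \<omega>)\<^sup>2)
               + (t - s) / (u - s) * expectation (\<lambda>\<omega>. X s \<omega> * X u \<omega>)"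
    using integrable_product[OF T(1) T(3)] square_integrable[OF T(1)] by simp
  finally show ?thesis using T by (simp add: distrib_left)
qed

lemma covariance_eq_product_expectation:
  assumes "s \<in> T" "t \<in> T"
  shows "covariance M (X s) (X t)
    = expectation (\<lambda>\<omega>. X s \<omega> * X t \<omega>) - expectation (X s) * expectation (X t)"
proof -
  have "covariance M (X s) (X t) = expectation (\<lambda>\<omega>. X s \<omega> * X t \<omega> - expectation (X t) * X s \<omega>
      - expectation (X s) * X t \<omega> + expectation (X s) * expectation (X t))"
    unfolding covariance_def by (intro Bochner_Integration.integral_cong) (auto simp: algebra_simps)
  also have "\<dots> = expectation (\<lambda>\<omega>. X s \<omega> * X t \<omega>) - expectation (X s) * expectation (X t)"
    using integrable_product[OF assms] integrable_process[OF assms(1)] integrable_process[OF assms(2)]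
    by (simp add: prob_space)
  finally show ?thesis .
qed

text \<open>The off-diagonal covariances determine the variances: conditioning \<open>X t\<close>, for \<open>s < t < u\<close>, on
  the \<sigma>-field of \<open>(s, u)\<close> expresses \<open>E (X s * X t)\<close> through \<open>E ((X s)\<^sup>2)\<close> and \<open>E (X s * X u)\<close>.\<close>

lemma variance_from_covariance:
  assumes T: "s \<in> T" "t \<in> T" "u \<in> T" "s < t" "t < u"
    and mean: "\<And>t. t \<in> T \<Longrightarrow> expectation (X t) = \<alpha> + \<beta> * t"
    and cov: "\<And>t. \<lbrakk>t \<in> T; s < t\<rbrakk> \<Longrightarrow> covariance M (X s) (X t) = k * (c * t + d)"
  shows "covariance M (X s) (X s) = k * (c * s + d)"
proof -
  let ?E = "\<lambda>t. expectation (\<lambda>\<omega>. X s \<omega> * X t \<omega>)"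
  have E: "?E t = k * (c * t + d) + (\<alpha> + \<beta> * s) * (\<alpha> + \<beta> * t)" if "t \<in> T" "s < t" for t
    using cov[OF that] covariance_eq_product_expectation[OF T(1) that(1)] mean[OF T(1)]
      mean[OF that(1)] by simp
  have var: "covariance M (X s) (X s) = ?E s - (\<alpha> + \<beta> * s) * (\<alpha> + \<beta> * s)"
    using covariance_eq_product_expectation[OF T(1) T(1)] mean[OF T(1)] by simp
  \<comment> \<open>The factor \<open>u - t\<close> lets the interpolation identity trade the
    unknown \<open>?E s\<close> for \<open>?E t\<close> and \<open>?E u\<close>, which are off the
    diagonal and hence known.\<close>
  have "(u - t) * (covariance M (X s) (X s) - k * (c * s + d))
      = (u - t) * ?E s - (u - t) * ((\<alpha> + \<beta> * s) * (\<alpha> + \<beta> * s) + k * (c * s + d))"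
    unfolding var by (simp add: algebra_simps)
  also have "(u - t) * ?E s = (u - s) * ?E t - (t - s) * ?E u"
    using second_moment_interpolation[OF T] by (simp add: power2_eq_square)
  \<comment> \<open>Off the diagonal \<open>?E\<close> is an affine function of its argument, and
    linear interpolation is exact on affine functions.\<close>
  also have "\<dots> - (u - t) * ((\<alpha> + \<beta> * s) * (\<alpha> + \<beta> * s) + k * (c * s + d)) = 0"
    using T by (simp add: E algebra_simps)
  finally have "(u - t) * (covariance M (X s) (X s) - k * (c * s + d)) = 0" .
  then show ?thesis using T by simp
qed

end

section \<open>The change of variables\<close>

text \<open>The numbers \<open>A\<close> and \<open>B\<close> of the proof are the intercept and
  slope of the chord through \<open>(S, x)\<close> and \<open>(U, y)\<close>. Multiplying the chord
  by \<open>c * s + d\<close> turns \<open>A + B * S\<close> into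
  \<open>(d * A + b * B) + (c * A + a * B) * s\<close>, again a line, now in \<open>s\<close>;
  adding \<open>\<alpha> + \<beta> * s\<close> shifts its intercept and slope. Dividing by
  \<open>K\<close> normalises the constant term to 1.\<close>

lemma harness_quadratic_moebius:
  fixes a b c d s u :: real
  assumes su: "s \<noteq> u" and p: "c * s + d \<noteq> 0" and q: "c * u + d \<noteq> 0"
    and D: "a * d - b * c \<noteq> 0" and K: "K \<noteq> 0"
    and K_def: "K = chi + \<alpha> * \<eta> + \<theta> * \<beta> + \<sigma> * \<alpha>\<^sup>2 + \<tau> * \<beta>\<^sup>2 + \<rho> * \<alpha> * \<beta>"
  shows "harness_quadratic chi \<eta> \<theta> \<sigma> \<tau> \<rho> s u
      (\<alpha> + \<beta> * s + (c * s + d) * x) (\<alpha> + \<beta> * u + (c * u + d) * y)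
    = K * harness_quadratic 1
        ((d * (\<eta> + \<beta> * \<rho> + 2 * \<alpha> * \<sigma>) + c * (\<theta> + \<alpha> * \<rho> + 2 * \<beta> * \<tau>)) / K)
        ((b * (\<eta> + \<beta> * \<rho> + 2 * \<alpha> * \<sigma>) + a * (\<theta> + \<alpha> * \<rho> + 2 * \<beta> * \<tau>)) / K)
        ((\<tau> * c\<^sup>2 + d * \<rho> * c + d\<^sup>2 * \<sigma>) / K)
        ((\<tau> * a\<^sup>2 + b * \<rho> * a + b\<^sup>2 * \<sigma>) / K)
        ((b * c * \<rho> + a * d * \<rho> + 2 * b * d * \<sigma> + 2 * a * c * \<tau>) / K)
        ((a * s + b) / (c * s + d)) ((a * u + b) / (c * u + d)) x y"
proof -
  \<comment> \<open>All parameters are generalised here because this form is applied once to the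
    original chord and once to the transformed one.\<close>
  have quadratic: "harness_quadratic chi \<eta> \<theta> \<sigma> \<tau> \<rho> s u x y
      = chi + \<eta> * A + \<theta> * B + \<sigma> * A\<^sup>2 + \<tau> * B\<^sup>2 + \<rho> * (A * B)"
    if "A = (u * x - s * y) / (u - s)" "B = (y - x) / (u - s)"
    for chi \<eta> \<theta> \<sigma> \<tau> \<rho> s u x y A B
    unfolding harness_quadratic_def that
    by (simp add: power_divide power2_eq_square ac_simps)
  define S U where "S = (a * s + b) / (c * s + d)" and "U = (a * u + b) / (c * u + d)"
  define A B where "A = (U * x - S * y) / (U - S)" and "B = (y - x) / (U - S)"
  define m n where "m = (c * s + d)" and "n = (c * u + d)"
  have mn: "m \<noteq> 0" "n \<noteq> 0" using p q by (auto simp: m_def n_def)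
  have S: "S * m = a * s + b" and U: "U * n = a * u + b"
    using p q by (auto simp: S_def U_def m_def n_def)
  have US: "(U - S) * (m * n) = (a * d - b * c) * (u - s)"
    using S U unfolding m_def n_def by algebra
  then have "U - S \<noteq> 0" using su D mn by auto
  then have A: "A * (U - S) = U * x - S * y" and B: "B * (U - S) = y - x"
    by (auto simp: A_def B_def)
  \<comment> \<open>Clears the denominators of any combination of \<open>A\<close> and
    \<open>B\<close>. It is needed for the coefficients \<open>d\<close>, \<open>b\<close> of the
    intercept and \<open>c\<close>, \<open>a\<close> of the slope.\<close>
  have scale: "(a * d - b * c) * ((p * A + q * B) * (u - s))
      = (p * (U * x - S * y) + q * (y - x)) * (m * n)" for p q
  proof -
    have "(a * d - b * c) * ((p * A + q * B) * (u - s)) = (p * A + q * B) * ((U - S) * (m * n))"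
      unfolding US by (simp only: mult_ac)
    also have "\<dots> = (p * (A * (U - S)) + q * (B * (U - S))) * (m * n)"
      by algebra
    finally show ?thesis unfolding A B .
  qed
  \<comment> \<open>The inverse map \<open>u = (d * U - b) / (a - c * U)\<close>, with its numerator
    and denominator each multiplied by \<open>n\<close>, and likewise for \<open>s\<close> with
    \<open>m\<close>.\<close>
  have lin: "n * (d * U - b) = (a * d - b * c) * u" "m * (d * S - b) = (a * d - b * c) * s"
    "n * (a - c * U) = a * d - b * c" "m * (a - c * S) = a * d - b * c"
    using S U unfolding m_def n_def by algebra+
  have "(\<alpha> + d * A + b * B) * (u - s)
      = u * (\<alpha> + \<beta> * s + m * x) - s * (\<alpha> + \<beta> * u + n * y)"
  proof -
    have "(a * d - b * c) * ((d * A + b * B) * (u - s)) = (a * d - b * c) * (u * m * x - s * n * y)"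
      (is "_ = ?D * _")
    proof -
      have "?D * ((d * A + b * B) * (u - s)) = (n * (d * U - b)) * (m * x) - (m * (d * S - b)) * (n * y)"
        unfolding scale by (simp add: algebra_simps)
      then show ?thesis unfolding lin by (simp add: algebra_simps)
    qed
    then have "(d * A + b * B) * (u - s) = u * m * x - s * n * y" using D by simp
    then show ?thesis by algebra
  qed
  then have X1: "\<alpha> + d * A + b * B
      = (u * (\<alpha> + \<beta> * s + m * x) - s * (\<alpha> + \<beta> * u + n * y)) / (u - s)"
    using su by (simp add: field_simps)
  have "(\<beta> + c * A + a * B) * (u - s) = (\<alpha> + \<beta> * u + n * y) - (\<alpha> + \<beta> * s + m * x)"
  proof -
    have "(a * d - b * c) * ((c * A + a * B) * (u - s)) = (a * d - b * c) * (n * y - m * x)"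
      (is "_ = ?D * _")
    proof -
      have "?D * ((c * A + a * B) * (u - s)) = (m * (a - c * S)) * (n * y) - (n * (a - c * U)) * (m * x)"
        unfolding scale by (simp add: algebra_simps)
      then show ?thesis unfolding lin by (simp only: right_diff_distrib)
    qed
    then have "(c * A + a * B) * (u - s) = n * y - m * x" using D by simp
    then show ?thesis by algebra
  qed
  then have X2: "\<beta> + c * A + a * B = ((\<alpha> + \<beta> * u + n * y) - (\<alpha> + \<beta> * s + m * x)) / (u - s)"
    using su by (simp add: field_simps)
  have cancel: "K * (p / K * q) = p * q" for p q using K by simp
  show ?thesis
    unfolding quadratic[OF X1[unfolded m_def n_def] X2[unfolded m_def n_def]]
      quadratic[OF A_def[unfolded S_def U_def] B_def[unfolded S_def U_def]]
      distrib_left[of K] cancel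
    \<comment> \<open>Expanding the left side, the constants add up to \<open>K\<close>, and the
      coefficients of \<open>A\<close>, \<open>B\<close>, their squares and their product are the
      five numerators.\<close>
    unfolding K_def by algebra
qed

text \<open>This identity yields both the monotonicity of the time change and the interpolation
  weights in the new time.\<close>

lemma moebius_difference:
  fixes a b c d s t :: real
  assumes "c * s + d \<noteq> 0" "c * t + d \<noteq> 0"
  shows "(a * t + b) / (c * t + d) - (a * s + b) / (c * s + d)
    = (a * d - b * c) * (t - s) / ((c * s + d) * (c * t + d))"
  using assms by (simp add: field_simps)

text \<open>A continuous function without zeros on an interval keeps one sign. Which sign it is
  stays open: \<open>c * t + d\<close> may be negative throughout.\<close>

lemma affine_same_sign:
  fixes c d s t :: real
  assumes I: "is_interval I" "s \<in> I" "t \<in> I" and nz: "\<And>x. x \<in> I \<Longrightarrow> c * x + d \<noteq> 0"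
  shows "0 < (c * s + d) * (c * t + d)"
proof (rule ccontr)
  assume "\<not> 0 < (c * s + d) * (c * t + d)"
  then have "c * s + d \<le> 0 \<and> 0 \<le> c * t + d \<or> c * t + d \<le> 0 \<and> 0 \<le> c * s + d"
    by (auto simp: not_less mult_le_0_iff)
  moreover have "is_interval ((\<lambda>x. c * x + d) ` I)"
    using I(1) connected_continuous_image[of I "\<lambda>x. c * x + d"]
    by (simp add: is_interval_connected_1 continuous_intros)
  ultimately have "0 \<in> (\<lambda>x. c * x + d) ` I"
    using I unfolding is_interval_1 by blast
  then show False using nz by auto
qed

theorem theorem3p1:
  fixes M :: "'a measure"
    and T\<^sub>0 T\<^sub>1 :: ereal
    and \<F> :: "real \<Rightarrow> real \<Rightarrow> 'a measure"
    and X :: "real \<Rightarrow> 'a \<Rightarrow> real"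
    and \<alpha> \<beta> a b c d chi \<eta> \<theta> \<sigma> \<tau> \<rho> :: real
    and V :: "real \<Rightarrow> real \<Rightarrow> real \<Rightarrow> real"
  assumes harness: "square_integrable_harness M (einterval T\<^sub>0 T\<^sub>1) \<F> X"
    and mean: "\<And>t. t \<in> einterval T\<^sub>0 T\<^sub>1 \<Longrightarrow> (\<integral>\<omega>. X t \<omega> \<partial>M) = \<alpha> + \<beta> * t"
    and cov: "\<And>s t. \<lbrakk>s \<in> einterval T\<^sub>0 T\<^sub>1; t \<in> einterval T\<^sub>0 T\<^sub>1; s < t\<rbrakk>
                \<Longrightarrow> covariance M (X s) (X t) = (a * s + b) * (c * t + d)"
    and det_pos: "a * d - b * c > 0"
    and factors_pos: "\<And>t. t \<in> einterval T\<^sub>0 T\<^sub>1 \<Longrightarrow> (a * t + b) * (c * t + d) > 0"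
    and cond_var: "\<And>s t u. \<lbrakk>s \<in> einterval T\<^sub>0 T\<^sub>1; t \<in> einterval T\<^sub>0 T\<^sub>1; u \<in> einterval T\<^sub>0 T\<^sub>1; s < t; t < u\<rbrakk>
                \<Longrightarrow> AE \<omega> in M. cond_variance M (\<F> s u) (X t) \<omega>
                      = V t s u * harness_quadratic chi \<eta> \<theta> \<sigma> \<tau> \<rho> s u (X s \<omega>) (X u \<omega>)"
    and chi_pos: "chi + \<alpha> * \<eta> + \<theta> * \<beta> + \<sigma> * \<alpha>\<^sup>2 + \<tau> * \<beta>\<^sup>2 + \<rho> * \<alpha> * \<beta> > 0"
  shows
    "let chi' = chi + \<alpha> * \<eta> + \<theta> * \<beta> + \<sigma> * \<alpha>\<^sup>2 + \<tau> * \<beta>\<^sup>2 + \<rho> * \<alpha> * \<beta>;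
         \<phi> = (\<lambda>t. (a * t + b) / (c * t + d));
         \<psi> = (\<lambda>t. (d * t - b) / (a - c * t));
         Y = (\<lambda>t \<omega>. (a - c * t) / (a * d - b * c) * (X (\<psi> t) \<omega> - \<alpha> - \<beta> * \<psi> t));
         \<eta>' = (d * (\<eta> + \<beta> * \<rho> + 2 * \<alpha> * \<sigma>) + c * (\<theta> + \<alpha> * \<rho> + 2 * \<beta> * \<tau>)) / chi';
         \<theta>' = (b * (\<eta> + \<beta> * \<rho> + 2 * \<alpha> * \<sigma>) + a * (\<theta> + \<alpha> * \<rho> + 2 * \<beta> * \<tau>)) / chi';
         \<sigma>' = (\<tau> * c\<^sup>2 + d * \<rho> * c + d\<^sup>2 * \<sigma>) / chi';
         \<tau>' = (\<tau> * a\<^sup>2 + b * \<rho> * a + b\<^sup>2 * \<sigma>) / chi';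
         \<rho>' = (b * c * \<rho> + a * d * \<rho> + 2 * b * d * \<sigma> + 2 * a * c * \<tau>) / chi'
     in \<exists>U\<^sub>0 U\<^sub>1 :: ereal.
          ((ereal \<circ> \<phi> \<circ> real_of_ereal) \<longlongrightarrow> U\<^sub>0) (at_right T\<^sub>0) \<and>
          ((ereal \<circ> \<phi> \<circ> real_of_ereal) \<longlongrightarrow> U\<^sub>1) (at_left T\<^sub>1) \<and>
          standard_quadratic_harness M (einterval U\<^sub>0 U\<^sub>1) (\<lambda>s u. \<F> (\<psi> s) (\<psi> u)) Y
            \<eta>' \<theta>' \<sigma>' \<tau>' (1 + \<rho>')"
proof -
  let ?T = "einterval T\<^sub>0 T\<^sub>1"
  interpret X: square_integrable_harness M ?T \<F> X by (rule harness)
  define D where "D = a * d - b * c"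
  define \<phi> where "\<phi> = (\<lambda>t. (a * t + b) / (c * t + d))"
  define \<psi> where "\<psi> = (\<lambda>t. (d * t - b) / (a - c * t))"
  define Y where "Y = (\<lambda>t \<omega>. (a - c * t) / (a * d - b * c) * (X (\<psi> t) \<omega> - \<alpha> - \<beta> * \<psi> t))"
  define K where "K = chi + \<alpha> * \<eta> + \<theta> * \<beta> + \<sigma> * \<alpha>\<^sup>2 + \<tau> * \<beta>\<^sup>2 + \<rho> * \<alpha> * \<beta>"
  have D: "0 < D" and K: "0 < K" using det_pos chi_pos by (simp_all add: D_def K_def)

  \<comment> \<open>The time change, its inverse and the transformed process\<close>
  have nz: "c * t + d \<noteq> 0" if "t \<in> ?T" for t using factors_pos[OF that] by auto
  have sign: "0 < (c * s + d) * (c * t + d)" if "s \<in> ?T" "t \<in> ?T" for s t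
    using affine_same_sign[OF is_interval_einterval that nz] by simp
  have diff: "\<phi> t - \<phi> s = D * (t - s) / ((c * s + d) * (c * t + d))"
    if "s \<in> ?T" "t \<in> ?T" for s t
    unfolding \<phi>_def D_def by (rule moebius_difference) (use nz that in auto)
  have less: "\<phi> s < \<phi> t \<longleftrightarrow> s < t" if "s \<in> ?T" "t \<in> ?T" for s t
  proof -
    have "\<phi> s < \<phi> t \<longleftrightarrow> 0 < \<phi> t - \<phi> s" by simp
    also have "\<dots> \<longleftrightarrow> s < t"
      unfolding diff[OF that] using sign[OF that] order_less_not_sym[OF sign[OF that]] D
      by (auto simp add: zero_less_divide_iff zero_less_mult_iff[of D])
    finally show ?thesis .
  qed
  have le: "\<phi> s \<le> \<phi> t \<longleftrightarrow> s \<le> t" if "s \<in> ?T" "t \<in> ?T" for s t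
    using less[OF that(2,1)] by (simp add: not_less[symmetric])
  have pos: "0 < \<phi> t" if "t \<in> ?T" for t
    using factors_pos[OF that] by (auto simp: \<phi>_def zero_less_divide_iff zero_less_mult_iff)
  \<comment> \<open>As \<open>D\<close> is positive, \<open>a - c * \<phi> t\<close> is nonzero, so
    \<open>\<psi>\<close> never divides by zero on the new time interval.\<close>
  have inv1: "(a - c * \<phi> t) * (c * t + d) = D" and inv2: "(d * \<phi> t - b) * (c * t + d) = D * t"
    if "t \<in> ?T" for t
  proof -
    have "\<phi> t * (c * t + d) = a * t + b" using nz[OF that] by (simp add: \<phi>_def)
    then show "(a - c * \<phi> t) * (c * t + d) = D" "(d * \<phi> t - b) * (c * t + d) = D * t"
      unfolding D_def by algebra+
  qed
  have \<psi>: "\<psi> (\<phi> t) = t" if "t \<in> ?T" for t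
  proof -
    have "\<psi> (\<phi> t) = ((d * \<phi> t - b) * (c * t + d)) / ((a - c * \<phi> t) * (c * t + d))"
      unfolding \<psi>_def using nz[OF that] by simp
    then show ?thesis using D by (simp add: inv1[OF that] inv2[OF that])
  qed
  have coeff: "(a - c * \<phi> t) / D = 1 / (c * t + d)" if "t \<in> ?T" for t
    using inv1[OF that] nz[OF that] D by (simp add: field_simps)
  \<comment> \<open>Written in the shape \<open>k * f x + m\<close> to fit the affine rules for
    conditional means and variances.\<close>
  have Y: "Y (\<phi> t) = (\<lambda>\<omega>. 1 / (c * t + d) * X t \<omega> + - ((\<alpha> + \<beta> * t) / (c * t + d)))"
    if "t \<in> ?T" for t
    unfolding Y_def \<psi>[OF that] D_def[symmetric] coeff[OF that]
    by (simp add: diff_divide_distrib add_divide_distrib fun_eq_iff)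
  have XY: "X t \<omega> = \<alpha> + \<beta> * t + (c * t + d) * Y (\<phi> t) \<omega>" if "t \<in> ?T" for t \<omega>
    using nz[OF that] by (simp add: Y[OF that] right_diff_distrib)

  \<comment> \<open>The new time interval and its endpoints\<close>
  have "continuous_on ?T \<phi>"
    unfolding \<phi>_def by (intro continuous_intros) (use nz in auto)
  moreover have "strict_mono_on ?T \<phi>" by (auto simp: strict_mono_on_def less)
  ultimately obtain U\<^sub>0 U\<^sub>1 :: ereal where
    lim: "((ereal \<circ> \<phi> \<circ> real_of_ereal) \<longlongrightarrow> U\<^sub>0) (at_right T\<^sub>0)"
      "((ereal \<circ> \<phi> \<circ> real_of_ereal) \<longlongrightarrow> U\<^sub>1) (at_left T\<^sub>1)"
    and img: "\<phi> ` ?T = einterval U\<^sub>0 U\<^sub>1"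
    using strict_mono_image_einterval[of T\<^sub>0 T\<^sub>1 \<phi>] X.times_nonempty by blast

  \<comment> \<open>Verification of the quadratic harness conditions in the new time\<close>
  have "standard_quadratic_harness M (\<phi> ` ?T) (\<lambda>s u. \<F> (\<psi> s) (\<psi> u)) Y
    ((d * (\<eta> + \<beta> * \<rho> + 2 * \<alpha> * \<sigma>) + c * (\<theta> + \<alpha> * \<rho> + 2 * \<beta> * \<tau>)) / K)
    ((b * (\<eta> + \<beta> * \<rho> + 2 * \<alpha> * \<sigma>) + a * (\<theta> + \<alpha> * \<rho> + 2 * \<beta> * \<tau>)) / K)
    ((\<tau> * c\<^sup>2 + d * \<rho> * c + d\<^sup>2 * \<sigma>) / K)
    ((\<tau> * a\<^sup>2 + b * \<rho> * a + b\<^sup>2 * \<sigma>) / K)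
    (1 + (b * c * \<rho> + a * d * \<rho> + 2 * b * d * \<sigma> + 2 * a * c * \<tau>) / K)"
    (is "standard_quadratic_harness _ _ _ _ ?\<eta> ?\<theta> ?\<sigma> ?\<tau> (1 + ?\<rho>)")
  proof unfold_locales
    show "\<phi> ` ?T \<noteq> {}" using X.times_nonempty by simp
    show "open (\<phi> ` ?T)" "is_interval (\<phi> ` ?T)" by (simp_all add: img is_interval_einterval)
    show "\<phi> ` ?T \<subseteq> {0<..}" using pos by auto
  next
    fix S U assume "S \<in> \<phi> ` ?T" "U \<in> \<phi> ` ?T" "S < U"
    then show "subalgebra M (\<F> (\<psi> S) (\<psi> U))" by (auto simp: less \<psi> intro: X.sub_sigma)
  next
    fix R S V U assume "R \<in> \<phi> ` ?T" "S \<in> \<phi> ` ?T" "V \<in> \<phi> ` ?T" "U \<in> \<phi> ` ?T"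
      "R \<le> S" "S < V" "V \<le> U"
    then show "sets (\<F> (\<psi> R) (\<psi> U)) \<subseteq> sets (\<F> (\<psi> S) (\<psi> V))"
      by (clarsimp simp: less le \<psi>) (meson X.past_future subsetD)
  next
    fix t' assume "t' \<in> \<phi> ` ?T"
    then obtain t where t: "t \<in> ?T" "t' = \<phi> t" by blast
    show "integrable M (Y t')" using X.integrable_process[OF t(1)] by (simp add: t Y)
    show "integrable M (\<lambda>\<omega>. (Y t' \<omega>)\<^sup>2)"
      unfolding t(2) Y[OF t(1)]
      by (intro integrable_square_add integrable_square_cmult X.square_integrable t)
        (use X.borel_measurable_process[OF t(1)] in auto)
    show "X.expectation (Y t') = 0"
      using X.integrable_process[OF t(1)] mean[OF t(1)]
      by (simp add: t Y X.prob_space add_divide_distrib)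
  next
    fix s' t' assume "s' \<in> \<phi> ` ?T" "t' \<in> \<phi> ` ?T" "s' < t'"
    then show "Y s' \<in> borel_measurable (\<F> (\<psi> s') (\<psi> t')) \<and> Y t' \<in> borel_measurable (\<F> (\<psi> s') (\<psi> t'))"
      by (auto simp: less \<psi> Y dest: X.adapted
          intro!: borel_measurable_diff borel_measurable_divide)
  next
    fix s' t' u' assume "s' \<in> \<phi> ` ?T" "t' \<in> \<phi> ` ?T" "u' \<in> \<phi> ` ?T" "s' < t'" "t' < u'"
    then obtain s t u where stu: "s \<in> ?T" "t \<in> ?T" "u \<in> ?T" "s < t" "t < u"
      and eq: "s' = \<phi> s" "t' = \<phi> t" "u' = \<phi> u"
      by (auto simp: less)
    interpret G: finite_measure_subalgebra M "\<F> s u"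
      using X.finite_measure_subalgebra_sigma stu by simp
    have su: "s < u" using stu by simp
    \<comment> \<open>For \<open>m = c * t + d\<close> and \<open>e = u - s\<close>, the first
      identity multiplies the harness equation out and the second divides back.\<close>
    have clear: "(1 / m * (p / e * x + q / e * y) + - (k / m)) * m * e = p * x + q * y - k * e"
      and solve: "z * m * e = p * x + q * y \<Longrightarrow> z = p / (e * m) * x + q / (e * m) * y"
      if "m \<noteq> 0" "e \<noteq> 0" for m e p q k x y z :: real
      using that by (simp_all add: field_simps)
    note nzs = nz[OF stu(1)] nz[OF stu(2)] nz[OF stu(3)]
    \<comment> \<open>In the differences of \<open>\<phi>\<close> the determinant and one affine
      factor cancel, leaving the old weights times a ratio of affine factors.\<close>
    have w: "(\<phi> u - \<phi> t) / (\<phi> u - \<phi> s) = (u - t) * (c * s + d) / ((u - s) * (c * t + d))"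
      "(\<phi> t - \<phi> s) / (\<phi> u - \<phi> s) = (t - s) * (c * u + d) / ((u - s) * (c * t + d))"
      using nzs su D by (simp_all add: diff stu)
    have "AE \<omega> in M. real_cond_exp M (\<F> s u) (Y t') \<omega>
        = 1 / (c * t + d) * real_cond_exp M (\<F> s u) (X t) \<omega> + - ((\<alpha> + \<beta> * t) / (c * t + d))"
      unfolding eq Y[OF stu(2)] by (intro G.real_cond_exp_affine X.integrable_process stu)
    then show "AE \<omega> in M. real_cond_exp M (\<F> (\<psi> s') (\<psi> u')) (Y t') \<omega>
        = (u' - t') / (u' - s') * Y s' \<omega> + (t' - s') / (u' - s') * Y u' \<omega>"
      unfolding eq \<psi>[OF stu(1)] \<psi>[OF stu(3)] w using X.harness_eq[OF stu]
    proof eventually_elim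
      case (elim \<omega>)
      define x y where "x = Y (\<phi> s) \<omega>" and "y = Y (\<phi> u) \<omega>"
      have "real_cond_exp M (\<F> s u) (Y (\<phi> t)) \<omega> * (c * t + d) * (u - s)
          = (u - t) * X s \<omega> + (t - s) * X u \<omega> - (\<alpha> + \<beta> * t) * (u - s)"
        unfolding elim using nzs(2) su by (intro clear) auto
      \<comment> \<open>The centring terms vanish because \<open>\<alpha> + \<beta> * t\<close> is
        interpolated exactly by its values at \<open>s\<close> and \<open>u\<close>.\<close>
      also have "\<dots> = (u - t) * (c * s + d) * x + (t - s) * (c * u + d) * y"
        unfolding XY[OF stu(1)] XY[OF stu(3)] x_def[symmetric] y_def[symmetric] by algebra
      finally show ?case
        unfolding x_def[symmetric] y_def[symmetric] using nzs(2) su by (intro solve) auto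
    qed
  next
    \<comment> \<open>Dividing \<open>(a * s + b) * (c * t + d)\<close> by the scalings at both
      times leaves \<open>\<phi> s\<close>, the smaller new time.\<close>
    have product: "X.expectation (\<lambda>\<omega>. Y (\<phi> s) \<omega> * Y (\<phi> t) \<omega>) = \<phi> s"
      if st: "s \<in> ?T" "t \<in> ?T" "s \<le> t" for s t
    proof -
      have "covariance M (X s) (X t) = (a * s + b) * (c * t + d)"
      proof (cases "s < t")
        case True
        then show ?thesis by (rule cov[OF st(1,2)])
      next
        case False
        then have "t = s" using st by simp
        \<comment> \<open>The covariance formula is given for distinct times only; two later times,
          available in an open interval, extend it to the diagonal.\<close>
        obtain v where v: "v \<in> ?T" "s < v" using einterval_dense[OF st(1)] .
        obtain w where w: "w \<in> ?T" "v < w" using einterval_dense[OF v(1)] .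
        show ?thesis unfolding \<open>t = s\<close>
          by (rule X.variance_from_covariance[OF st(1) v(1) w(1) v(2) w(2) mean])
            (use cov[OF st(1)] in auto)
      qed
      moreover have "covariance M (X s) (X t)
          = X.expectation (\<lambda>\<omega>. ((c * s + d) * (c * t + d)) * (Y (\<phi> s) \<omega> * Y (\<phi> t) \<omega>))"
        unfolding covariance_def mean[OF st(1)] mean[OF st(2)]
        by (rule Bochner_Integration.integral_cong) (auto simp: XY st algebra_simps)
      ultimately have "(c * s + d) * (c * t + d) * X.expectation (\<lambda>\<omega>. Y (\<phi> s) \<omega> * Y (\<phi> t) \<omega>)
          = (a * s + b) * (c * t + d)"
        by simp
      moreover have "a * s + b = (c * s + d) * \<phi> s" using nz[OF st(1)] by (simp add: \<phi>_def)
      ultimately show ?thesis using nz[OF st(1)] nz[OF st(2)] by simp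
    qed
    fix s' t' assume "s' \<in> \<phi> ` ?T" "t' \<in> \<phi> ` ?T"
    then obtain s t where st: "s \<in> ?T" "t \<in> ?T" "s' = \<phi> s" "t' = \<phi> t" by blast
    show "X.expectation (\<lambda>\<omega>. Y s' \<omega> * Y t' \<omega>) = min s' t'"
    proof (cases "s \<le> t")
      case True
      then show ?thesis using product[OF st(1,2)] le[OF st(1,2)] by (simp add: st)
    next
      case False
      then show ?thesis using product[OF st(2,1)] le[OF st(2,1)]
        by (simp add: st mult.commute)
    qed
  next
    \<comment> \<open>\<open>K\<close> comes from normalising the constant term and the squared
      denominator from the scaling of \<open>X t\<close>; \<open>\<psi>\<close> carries the new
      times back to the old ones.\<close>
    let ?V = "\<lambda>t s u. K * V (\<psi> t) (\<psi> s) (\<psi> u) / (c * \<psi> t + d)\<^sup>2"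
    have "AE \<omega> in M. cond_variance M (\<F> (\<psi> (\<phi> s)) (\<psi> (\<phi> u))) (Y (\<phi> t)) \<omega>
        = ?V (\<phi> t) (\<phi> s) (\<phi> u)
          * harness_quadratic 1 ?\<eta> ?\<theta> ?\<sigma> ?\<tau> ?\<rho> (\<phi> s) (\<phi> u) (Y (\<phi> s) \<omega>) (Y (\<phi> u) \<omega>)"
      if stu: "s \<in> ?T" "t \<in> ?T" "u \<in> ?T" "s < t" "t < u" for s t u
    proof -
      have quad: "harness_quadratic chi \<eta> \<theta> \<sigma> \<tau> \<rho> s u (X s \<omega>) (X u \<omega>)
          = K * harness_quadratic 1 ?\<eta> ?\<theta> ?\<sigma> ?\<tau> ?\<rho> (\<phi> s) (\<phi> u) (Y (\<phi> s) \<omega>) (Y (\<phi> u) \<omega>)" for \<omega>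
        unfolding XY[OF stu(1)] XY[OF stu(3)]
        \<comment> \<open>The two time arguments have to appear as fractions, while the values of
          \<open>Y\<close> stay folded as the \<open>x\<close> and \<open>y\<close> of the chord
          identity.\<close>
        by (subst \<phi>_def, subst (2) \<phi>_def)
          (rule harness_quadratic_moebius; use stu nz K D in \<open>auto simp: K_def D_def\<close>)
      show ?thesis
        unfolding \<psi>[OF stu(1)] \<psi>[OF stu(2)] \<psi>[OF stu(3)] Y[OF stu(2)]
        using X.cond_variance_affine_process[OF stu, of "1 / (c * t + d)" "- ((\<alpha> + \<beta> * t) / (c * t + d))"]
          cond_var[OF stu]
        by eventually_elim (simp add: quad power_divide)
    qed
    then show "\<exists>V. \<forall>s\<in>\<phi> ` ?T. \<forall>t\<in>\<phi> ` ?T. \<forall>u\<in>\<phi> ` ?T. s < t \<and> t < u \<longrightarrow>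
        (AE \<omega> in M. cond_variance M (\<F> (\<psi> s) (\<psi> u)) (Y t) \<omega>
          = V t s u * harness_quadratic 1 ?\<eta> ?\<theta> ?\<sigma> ?\<tau> (- (1 - (1 + ?\<rho>))) s u (Y s \<omega>) (Y u \<omega>))"
      by (intro exI[of _ ?V]) (simp add: less)
  qed
  \<comment> \<open>Only here does the index set become an explicit interval; until now every new
    time could be written as \<open>\<phi> t\<close> with an old time \<open>t\<close>.\<close>
  from this[unfolded img] lim show ?thesis
    unfolding Let_def K_def \<phi>_def Y_def \<psi>_def by blast
qed

end
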